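(* Let $X$ be a completely regular space. The following are equivalent: (1) $X$ is a perfectly regular space (that is, each singleton $\{x\}$, $x\in X$, is a $G_\delta$-set). (2) $\{x\}$ is a zero-set for each $x\in X$. (3) Each closed subset of $X$ is the union of the zero-sets of $X$ contained in it. (4) For each closed subset $F$ of $X$, the union of all the zero-sets of $X$ contained in $F$ is dense in $F$. (5) Each open subset of $X$ is the interior of the intersection of the cozero-sets of $X$ containing it.
   Context: Completely regular spaces are assumed to be $T_1$ (hence Hausdorff, i.e. Tychonoff). A $G_\delta$-set is a countable intersection of open sets. A zero-set of $X$ is a set of the form $f^{-1}(0)$ with $f:X\to\mathbb{R}$ continuous; a cozero-set is the complement of a zero-set. A completely regular space is called perfectly regular if each singleton is a $G_\delta$-set. *)

theory Defs
  imports "HOL-Analysis.Analysis"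
begin

definition zero_set_in :: "'a topology \<Rightarrow> 'a set \<Rightarrow> bool" where
  "zero_set_in X Z \<longleftrightarrow>
     (\<exists>f::'a \<Rightarrow> real. continuous_map X euclideanreal f \<and> Z = {x \<in> topspace X. f x = 0})"

definition cozero_set_in :: "'a topology \<Rightarrow> 'a set \<Rightarrow> bool" where
  "cozero_set_in X U \<longleftrightarrow> (\<exists>Z. zero_set_in X Z \<and> U = topspace X - Z)"

(* The library's completely_regular_space does not include the T1 axiom. *)
definition tychonoff_space :: "'a topology \<Rightarrow> bool" where
  "tychonoff_space X \<longleftrightarrow> completely_regular_space X \<and> t1_space X"

definition perfectly_regular_space :: "'a topology \<Rightarrow> bool" where
  "perfectly_regular_space X \<longleftrightarrow>
     tychonoff_space X \<and> (\<forall>x \<in> topspace X. gdelta_in X {x})"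

definition dense_in :: "'a topology \<Rightarrow> 'a set \<Rightarrow> bool" where
  "dense_in X D \<longleftrightarrow> D \<subseteq> topspace X \<and> X closure_of D = topspace X"

end

(* The only analytic point is that a countable intersection of zero-sets is a zero-set, via the
   uniformly convergent series of the functions min |f n| 2^-n.  Complete regularity makes a
   G_delta singleton such an intersection.  Applying (4) to the closed set {x} forces a nonempty
   zero-set inside {x}, which closes the cycle; (4) and (5) are complementary. *)
theory Submission
  imports Defs
begin

lemma zero_set_in_subset: "zero_set_in X Z \<Longrightarrow> Z \<subseteq> topspace X"
  by (auto simp: zero_set_in_def)

text \<open>The point 0 is closed in a metrizable space, hence a G_delta in the reals, and
  continuous preimages preserve open sets and intersections.\<close>

lemma zero_set_in_gdelta:
  assumes "zero_set_in X Z"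
  shows "gdelta_in X Z"
proof -
  obtain f :: "'a \<Rightarrow> real" where f: "continuous_map X euclideanreal f"
    and Z: "Z = {x \<in> topspace X. f x = 0}"
    using assms unfolding zero_set_in_def by blast
  have "gdelta_in euclideanreal {0}"
    by (intro closed_imp_gdelta_in metrizable_space_euclidean) auto
  then obtain C where C: "\<And>n::nat. openin euclideanreal (C n)" "\<Inter>(range C) = {0}"
    unfolding gdelta_in_descending by blast
  have "gdelta_in X (\<Inter>(range (\<lambda>n. {x \<in> topspace X. f x \<in> C n})))"
    using openin_continuous_map_preimage[OF f C(1)]
    by (intro gdelta_in_Inter) (auto intro: open_imp_gdelta_in)
  moreover have "\<Inter>(range (\<lambda>n. {x \<in> topspace X. f x \<in> C n})) = Z"
    using C(2) unfolding Z by auto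
  ultimately show ?thesis
    by simp
qed

lemma zero_set_in_INT:
  fixes Z :: "nat \<Rightarrow> 'a set"
  assumes "\<And>n. zero_set_in X (Z n)"
  shows "zero_set_in X (\<Inter>n. Z n)"
proof -
  have "\<forall>n. \<exists>f::'a \<Rightarrow> real. continuous_map X euclideanreal f \<and> Z n = {x \<in> topspace X. f x = 0}"
    using assms unfolding zero_set_in_def by blast
  then obtain f :: "nat \<Rightarrow> 'a \<Rightarrow> real" where f: "\<And>n. continuous_map X euclideanreal (f n)"
    and Z: "\<And>n. Z n = {x \<in> topspace X. f n x = 0}"
    by metis
  \<comment> \<open>The cap \<open>(1/2) ^ n\<close> provides the summable majorant for the
    Weierstrass M-test; being positive, it creates no new zeros.\<close>
  define g where "g n x = min \<bar>f n x\<bar> ((1/2) ^ n)" for n x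
  have g_nonneg: "g n x \<ge> 0" and g_le: "norm (g n x) \<le> (1/2) ^ n" for n x
    by (auto simp: g_def)
  have g_zero: "g n x = 0 \<longleftrightarrow> f n x = 0" for n x
    by (auto simp: g_def min_def)
  have geo: "summable (\<lambda>n. (1/2::real) ^ n)"
    by (intro summable_geometric) auto
  have unif: "uniform_limit (topspace X) (\<lambda>n x. \<Sum>i<n. g i x) (\<lambda>x. \<Sum>i. g i x) sequentially"
    using g_le geo by (rule Weierstrass_m_test)
  have "continuous_map X euclideanreal (g n)" for n
    unfolding g_def by (intro continuous_map_real_min continuous_map_real_abs f) auto
  then have sums: "continuous_map X euclideanreal (\<lambda>x. \<Sum>i<n. g i x)" for n
    by (intro continuous_map_sum) auto
  \<comment> \<open>\<open>Met_TC.mtopology\<close> is the usual topology of the reals in metric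
    form, so the theorem on uniform limits of continuous maps into a metric space applies to the
    partial sums.\<close>
  have "continuous_map X Met_TC.mtopology (\<lambda>x. \<Sum>i. g i x)"
    using sums unif
    by (intro Met_TC.continuous_map_uniform_limit[where F = sequentially and f = "\<lambda>n x. \<Sum>i<n. g i x"])
       (auto simp: uniform_limit_iff)
  then have "continuous_map X euclideanreal (\<lambda>x. \<Sum>i. g i x)"
    by simp
  moreover have "summable (\<lambda>i. g i x)" for x
    by (rule summable_comparison_test'[OF geo g_le])
  \<comment> \<open>A convergent series of nonnegative terms vanishes only if every term
    does.\<close>
  then have "(\<Sum>i. g i x) = 0 \<longleftrightarrow> (\<forall>n. f n x = 0)" for x
    using g_nonneg by (simp add: suminf_eq_zero_iff g_zero)
  then have "(\<Inter>n. Z n) = {x \<in> topspace X. (\<Sum>i. g i x) = 0}"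
    by (auto simp: Z)
  ultimately show ?thesis
    unfolding zero_set_in_def by blast
qed

lemma gdelta_singleton_imp_zero_set_in:
  assumes "completely_regular_space X" "gdelta_in X {x}"
  shows "zero_set_in X {x}"
proof -
  obtain C where C: "\<And>n::nat. openin X (C n)" "\<Inter>(range C) = {x}"
    using assms(2) unfolding gdelta_in_descending by blast
  \<comment> \<open>Separate \<open>x\<close> from the closed complement of \<open>C n\<close>: the
    value 1 there confines the zeros of \<open>f\<close> to \<open>C n\<close>.\<close>
  have "\<exists>f. continuous_map X euclideanreal f \<and> f x = 0 \<and> f ` (topspace X - C n) \<subseteq> {1}" for n
  proof -
    have "x \<in> \<Inter>(range C)"
      by (simp add: C(2))
    then have "x \<in> C n"
      by simp
    then show ?thesis
      using assms(1) C(1) by (simp add: completely_regular_space_alt')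
  qed
  then obtain f :: "nat \<Rightarrow> 'a \<Rightarrow> real" where f: "\<And>n. continuous_map X euclideanreal (f n)"
    "\<And>n. f n x = 0" "\<And>n. f n ` (topspace X - C n) \<subseteq> {1}"
    by metis
  have "zero_set_in X (\<Inter>n. {y \<in> topspace X. f n y = 0})"
    using f(1) by (intro zero_set_in_INT) (auto simp: zero_set_in_def)
  moreover have "{y \<in> topspace X. f n y = 0} \<subseteq> C n" for n
    using f(3)[of n] by force
  then have "(\<Inter>n. {y \<in> topspace X. f n y = 0}) \<subseteq> {x}"
    unfolding C(2)[symmetric] by (rule INF_mono')
  then have "(\<Inter>n. {y \<in> topspace X. f n y = 0}) = {x}"
    using f(2) gdelta_in_subset[OF assms(2)] by auto
  ultimately show ?thesis
    by simp
qed

text \<open>The closure in the subspace is the trace on \<open>F\<close> of the closure in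
  \<open>X\<close>, and the latter stays inside the closed set \<open>F\<close>. This frees (4) from
  subspaces.\<close>

lemma dense_in_closed_subtopology:
  assumes "closedin X F" "D \<subseteq> F"
  shows "dense_in (subtopology X F) D \<longleftrightarrow> X closure_of D = F"
proof -
  have "X closure_of D \<subseteq> F" "F \<subseteq> topspace X"
    using assms by (simp_all add: closure_of_minimal closedin_subset)
  then show ?thesis
    using assms(2) by (auto simp: dense_in_def closure_of_subtopology Int_absorb1 Int_absorb2)
qed

text \<open>De Morgan: complementation matches the cozero-sets containing \<open>U\<close> with the
  zero-sets disjoint from \<open>U\<close>.\<close>

lemma Inter_cozero_sets_eq:
  assumes "U \<subseteq> topspace X"
  shows "\<Inter>{C. cozero_set_in X C \<and> U \<subseteq> C} =
         topspace X - \<Union>{Z. zero_set_in X Z \<and> Z \<subseteq> topspace X - U}"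
    (is "\<Inter>?C = topspace X - \<Union>?Z")
proof -
  have "?C = (\<lambda>Z. topspace X - Z) ` ?Z"
    using assms zero_set_in_subset by (fastforce simp: cozero_set_in_def)
  \<comment> \<open>The family must be nonempty, since an empty intersection would be
    \<open>UNIV\<close> rather than \<open>topspace X\<close>.\<close>
  moreover have "zero_set_in X {}"
    unfolding zero_set_in_def by (rule exI[of _ "\<lambda>_. 1"]) auto
  then have "?Z \<noteq> {}"
    by blast
  ultimately show ?thesis
    by auto
qed

theorem theorem2p1:
  fixes X :: "'a topology"
  assumes "tychonoff_space X"
  defines "P1 \<equiv> perfectly_regular_space X"
    and "P2 \<equiv> (\<forall>x \<in> topspace X. zero_set_in X {x})"
    and "P3 \<equiv> (\<forall>F. closedin X F \<longrightarrow> F = \<Union>{Z. zero_set_in X Z \<and> Z \<subseteq> F})"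
    and "P4 \<equiv> (\<forall>F. closedin X F \<longrightarrow>
                 dense_in (subtopology X F) (\<Union>{Z. zero_set_in X Z \<and> Z \<subseteq> F}))"
    and "P5 \<equiv> (\<forall>U. openin X U \<longrightarrow>
                 U = X interior_of (\<Inter>{C. cozero_set_in X C \<and> U \<subseteq> C}))"
  shows "(P1 \<longleftrightarrow> P2) \<and> (P2 \<longleftrightarrow> P3) \<and> (P3 \<longleftrightarrow> P4) \<and> (P4 \<longleftrightarrow> P5)"
proof -
  define W where "W F = \<Union>{Z. zero_set_in X Z \<and> Z \<subseteq> F}" for F
  have W_subset: "W F \<subseteq> F" for F
    by (auto simp: W_def)
  have P4_iff: "P4 \<longleftrightarrow> (\<forall>F. closedin X F \<longrightarrow> X closure_of W F = F)"
    unfolding P4_def W_def[symmetric] by (simp add: dense_in_closed_subtopology W_subset)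
  have "P1 \<longleftrightarrow> P2"
    using assms(1) gdelta_singleton_imp_zero_set_in[of X] zero_set_in_gdelta[of X]
    by (auto simp: P1_def P2_def perfectly_regular_space_def tychonoff_space_def)
  \<comment> \<open>A closed set is the union of its singletons, which are zero-sets by
    \<open>P2\<close>.\<close>
  moreover have "P2 \<Longrightarrow> P3"
    unfolding P2_def P3_def using closedin_subset by blast
  moreover have "P3 \<Longrightarrow> P4"
    unfolding P3_def P4_iff W_def[symmetric] by (metis closure_of_closedin)
  moreover have "P4 \<Longrightarrow> P2"
    unfolding P2_def
  proof
    fix x
    assume "P4" "x \<in> topspace X"
    \<comment> \<open>The T1 axiom makes \<open>{x}\<close> closed, so \<open>P4\<close> applies to
      it; \<open>W {x}\<close> cannot be empty, because the empty set has empty closure.\<close>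
    then have "X closure_of W {x} = {x}"
      using assms(1) by (simp add: P4_iff tychonoff_space_def t1_space_closedin_singleton)
    then have "W {x} \<noteq> {}"
      by auto
    then obtain Z where "zero_set_in X Z" "Z \<subseteq> {x}" "Z \<noteq> {}"
      unfolding W_def by blast
    then show "zero_set_in X {x}"
      by (metis subset_singletonD)
  qed
  moreover have "P4 \<longleftrightarrow> P5"
  proof -
    \<comment> \<open>With \<open>F = topspace X - U\<close>, the intersection is the complement of
      \<open>W F\<close>, and its interior is the complement of the closure of \<open>W F\<close>.
      Taking complements in \<open>topspace X\<close> turns the condition on \<open>U\<close> into
      the one on \<open>F\<close>.\<close>
    have "U = X interior_of (\<Inter>{C. cozero_set_in X C \<and> U \<subseteq> C}) \<longleftrightarrow>
          X closure_of W (topspace X - U) = topspace X - U" if "openin X U" for U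
    proof -
      have "U \<subseteq> topspace X"
        using that by (rule openin_subset)
      moreover have "X closure_of W (topspace X - U) \<subseteq> topspace X"
        by (rule closure_of_subset_topspace)
      ultimately show ?thesis
        by (simp add: Inter_cozero_sets_eq interior_of_complement flip: W_def) blast
    qed
    then show ?thesis
      unfolding P4_iff P5_def all_closedin by simp
  qed
  ultimately show ?thesis
    by blast
qed

end
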